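(* (A) If a proper finitary structure $\mathcal F$ of dGECs satisfies both the conditions (MBP) and (OBP), then there exists a cardinal $\mathfrak m$ such that each dGEC finitely represented in $\mathcal F$ has size not greater than $\mathfrak m$. (B) All skeletons (of AB-HO dGECs) satisfy (MBP) and (OBP). The size of an AB-HO dGEC whose palette has size $\alpha\geq\aleph_0$ does not exceed $2^\alpha$. An AB-HO dGEC is of finite size iff so is its palette.
   Context: A directed GEC (dGEC) is a pair $\mathfrak G=(V,\kappa)$ where $V$ is a set (of vertices) and $\kappa$ is a function defined on $V\times V$ such that for all $x,y,z\in V$: $\kappa(x,y)=\kappa(z,z)\iff x=y$. The palette is $\{\kappa(x,y): x\neq y\}$ (elements are colors), the common value $\kappa(z,z)$ is the pseudocolor, and the size is the cardinality of $V$. A sub-dGEC is a restriction $(A,\kappa\restriction_{A\times A})$, $A\subset V$. A partial morphism from $(V,\kappa)$ into $(W,\lambda)$ is a function $f\colon A\to W$ with $A\subset V$ and $\kappa(a,b)=\lambda(f(a),f(b))$ for all $a,b\in A$; an isomorphism is a bijective one with $A=V$; an automorphism is a self-isomorphism. A dGEC is absolutely homogeneous (AB-HO) if every partial morphism from it into itself extends to an automorphism. A finitary structure of dGECs is a class of finite non-empty dGECs closed under taking non-empty sub-dGECs and under isomorphic copies. Its palette consists of all colors of edges of its members. It is proper if its palette is a set and all its members have the same pseudocolor. A dGEC is finitely represented in $\mathcal F$ if all its non-empty finite sub-dGECs belong to $\mathcal F$. The skeleton of an AB-HO dGEC is the finitary structure consisting of all (isomorphic copies of) its finite non-empty sub-dGECs.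 (MBP): for each color $c$ from the palette of $\mathcal F$ there is a positive integer $\mu(c)$ such that each $c$-monochromatic member $(V,\kappa)$ of $\mathcal F$ (i.e. $\kappa(x,y)=c$ for all distinct $x,y\in V$) has size at most $\mu(c)$. For distinct colors $c,d$, a dGEC $(W,\kappa)$ is $(c,d)$-ordered if there is a total order $\preceq$ on $W$ such that for any two distinct $u,v\in W$: $u\preceq v\iff\kappa(u,v)=c\iff\kappa(v,u)=d$. (OBP): for any two distinct colors $c$ and $d$ from the palette of $\mathcal F$ there is a positive integer $\mu(c,d)$ such that any $(c,d)$-ordered dGEC belonging to $\mathcal F$ has size at most $\mu(c,d)$. *)

theory Defs
  imports Main
begin

unbundle cardinal_syntax

text \<open>A dGEC is a set \<open>V\<close> together with a function \<open>\<kappa>\<close>, of which only the values on \<open>V \<times> V\<close> are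
  relevant. Hence \<open>(A, \<kappa>)\<close> with \<open>A \<subseteq> V\<close> serves as the sub-dGEC of \<open>(V, \<kappa>)\<close> on \<open>A\<close>.\<close>

definition dgec :: "'v set \<Rightarrow> ('v \<Rightarrow> 'v \<Rightarrow> 'c) \<Rightarrow> bool" where
  "dgec V \<kappa> \<longleftrightarrow> (\<forall>x\<in>V. \<forall>y\<in>V. \<forall>z\<in>V. \<kappa> x y = \<kappa> z z \<longleftrightarrow> x = y)"

definition palette :: "'v set \<Rightarrow> ('v \<Rightarrow> 'v \<Rightarrow> 'c) \<Rightarrow> 'c set" where
  "palette V \<kappa> = {\<kappa> x y | x y. x \<in> V \<and> y \<in> V \<and> x \<noteq> y}"

definition partial_morphism ::
  "'v set \<Rightarrow> ('v \<Rightarrow> 'v \<Rightarrow> 'c) \<Rightarrow> 'w set \<Rightarrow> ('w \<Rightarrow> 'w \<Rightarrow> 'c) \<Rightarrow> 'v set \<Rightarrow> ('v \<Rightarrow> 'w) \<Rightarrow> bool" where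
  "partial_morphism V \<kappa> W \<kappa>' A f \<longleftrightarrow>
     A \<subseteq> V \<and> f ` A \<subseteq> W \<and> (\<forall>a\<in>A. \<forall>b\<in>A. \<kappa> a b = \<kappa>' (f a) (f b))"

definition isomorphism ::
  "'v set \<Rightarrow> ('v \<Rightarrow> 'v \<Rightarrow> 'c) \<Rightarrow> 'w set \<Rightarrow> ('w \<Rightarrow> 'w \<Rightarrow> 'c) \<Rightarrow> ('v \<Rightarrow> 'w) \<Rightarrow> bool" where
  "isomorphism V \<kappa> W \<kappa>' f \<longleftrightarrow> partial_morphism V \<kappa> W \<kappa>' V f \<and> bij_betw f V W"

definition isomorphic ::
  "'v set \<Rightarrow> ('v \<Rightarrow> 'v \<Rightarrow> 'c) \<Rightarrow> 'w set \<Rightarrow> ('w \<Rightarrow> 'w \<Rightarrow> 'c) \<Rightarrow> bool" where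
  "isomorphic V \<kappa> W \<kappa>' \<longleftrightarrow> (\<exists>f. isomorphism V \<kappa> W \<kappa>' f)"

definition automorphism :: "'v set \<Rightarrow> ('v \<Rightarrow> 'v \<Rightarrow> 'c) \<Rightarrow> ('v \<Rightarrow> 'v) \<Rightarrow> bool" where
  "automorphism V \<kappa> g \<longleftrightarrow> isomorphism V \<kappa> V \<kappa> g"

text \<open>Absolutely homogeneous (AB-HO) dGECs; the domain \<open>A\<close> may be infinite.\<close>

definition ab_ho :: "'v set \<Rightarrow> ('v \<Rightarrow> 'v \<Rightarrow> 'c) \<Rightarrow> bool" where
  "ab_ho V \<kappa> \<longleftrightarrow> dgec V \<kappa> \<and>
     (\<forall>A f. partial_morphism V \<kappa> V \<kappa> A f \<longrightarrow>
        (\<exists>g. automorphism V \<kappa> g \<and> (\<forall>a\<in>A. g a = f a)))"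

text \<open>A class of finite dGECs that is closed under isomorphic copies is determined by its members
  whose vertices are natural numbers, and it is represented by the set of these.\<close>

type_synonym 'c dgec_class = "(nat set \<times> (nat \<Rightarrow> nat \<Rightarrow> 'c)) set"

definition finitary_structure :: "'c dgec_class \<Rightarrow> bool" where
  "finitary_structure F \<longleftrightarrow>
     (\<forall>(V, \<kappa>)\<in>F. dgec V \<kappa> \<and> finite V \<and> V \<noteq> {}) \<and>
     (\<forall>(V, \<kappa>)\<in>F. \<forall>A. A \<subseteq> V \<and> A \<noteq> {} \<longrightarrow> (A, \<kappa>) \<in> F) \<and>
     (\<forall>(V, \<kappa>)\<in>F. \<forall>W \<kappa>'. dgec W \<kappa>' \<and> isomorphic V \<kappa> W \<kappa>' \<longrightarrow> (W, \<kappa>') \<in> F)"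

definition class_palette :: "'c dgec_class \<Rightarrow> 'c set" where
  "class_palette F = (\<Union>(V, \<kappa>)\<in>F. palette V \<kappa>)"

text \<open>Colors are elements of a type, so the palette of a finitary structure is always a set; it
  remains to require a common pseudocolor.\<close>

definition proper_finitary_structure :: "'c dgec_class \<Rightarrow> bool" where
  "proper_finitary_structure F \<longleftrightarrow>
     finitary_structure F \<and> (\<exists>p. \<forall>(V, \<kappa>)\<in>F. \<forall>z\<in>V. \<kappa> z z = p)"

text \<open>A finite dGEC over an arbitrary type of vertices belongs to the class represented by \<open>F\<close> iff
  it is isomorphic to an element of \<open>F\<close>.\<close>

definition belongs_to :: "'v set \<Rightarrow> ('v \<Rightarrow> 'v \<Rightarrow> 'c) \<Rightarrow> 'c dgec_class \<Rightarrow> bool" where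
  "belongs_to V \<kappa> F \<longleftrightarrow> (\<exists>(W, \<kappa>')\<in>F. isomorphic V \<kappa> W \<kappa>')"

definition finitely_represented :: "'v set \<Rightarrow> ('v \<Rightarrow> 'v \<Rightarrow> 'c) \<Rightarrow> 'c dgec_class \<Rightarrow> bool" where
  "finitely_represented V \<kappa> F \<longleftrightarrow>
     (\<forall>A. A \<subseteq> V \<and> finite A \<and> A \<noteq> {} \<longrightarrow> belongs_to A \<kappa> F)"

definition skeleton :: "'v set \<Rightarrow> ('v \<Rightarrow> 'v \<Rightarrow> 'c) \<Rightarrow> 'c dgec_class" where
  "skeleton V \<kappa> =
     {(W, \<kappa>'). dgec W \<kappa>' \<and> (\<exists>A. A \<subseteq> V \<and> finite A \<and> A \<noteq> {} \<and> isomorphic A \<kappa> W \<kappa>')}"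

definition monochromatic :: "'c \<Rightarrow> 'v set \<Rightarrow> ('v \<Rightarrow> 'v \<Rightarrow> 'c) \<Rightarrow> bool" where
  "monochromatic c V \<kappa> \<longleftrightarrow> (\<forall>x\<in>V. \<forall>y\<in>V. x \<noteq> y \<longrightarrow> \<kappa> x y = c)"

definition MBP :: "'c dgec_class \<Rightarrow> bool" where
  "MBP F \<longleftrightarrow>
     (\<forall>c\<in>class_palette F. \<exists>\<mu>::nat. \<mu> > 0 \<and>
        (\<forall>(V, \<kappa>)\<in>F. monochromatic c V \<kappa> \<longrightarrow> card V \<le> \<mu>))"

definition cd_ordered :: "'c \<Rightarrow> 'c \<Rightarrow> 'v set \<Rightarrow> ('v \<Rightarrow> 'v \<Rightarrow> 'c) \<Rightarrow> bool" where
  "cd_ordered c d W \<kappa> \<longleftrightarrow>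
     (\<exists>r. linear_order_on W r \<and>
        (\<forall>u\<in>W. \<forall>v\<in>W. u \<noteq> v \<longrightarrow>
           ((u, v) \<in> r \<longleftrightarrow> \<kappa> u v = c) \<and> (\<kappa> u v = c \<longleftrightarrow> \<kappa> v u = d)))"

definition OBP :: "'c dgec_class \<Rightarrow> bool" where
  "OBP F \<longleftrightarrow>
     (\<forall>c\<in>class_palette F. \<forall>d\<in>class_palette F. c \<noteq> d \<longrightarrow>
        (\<exists>\<mu>::nat. \<mu> > 0 \<and> (\<forall>(V, \<kappa>)\<in>F. cd_ordered c d V \<kappa> \<longrightarrow> card V \<le> \<mu>)))"

lemma isomorphic_trans:
  assumes "isomorphic U \<kappa> V \<kappa>'" "isomorphic V \<kappa>' W \<kappa>''"
  shows "isomorphic U \<kappa> W \<kappa>''"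
proof -
  obtain f where f: "bij_betw f U V" "\<forall>a\<in>U. \<forall>b\<in>U. \<kappa> a b = \<kappa>' (f a) (f b)"
    using assms by (auto simp: isomorphic_def isomorphism_def partial_morphism_def)
  obtain g where g: "bij_betw g V W" "\<forall>a\<in>V. \<forall>b\<in>V. \<kappa>' a b = \<kappa>'' (g a) (g b)"
    using assms by (auto simp: isomorphic_def isomorphism_def partial_morphism_def)
  have "bij_betw (g \<circ> f) U W"
    using f(1) g(1) by (rule bij_betw_trans)
  moreover have "\<forall>a\<in>U. \<forall>b\<in>U. \<kappa> a b = \<kappa>'' ((g \<circ> f) a) ((g \<circ> f) b)"
    using f g by (simp add: bij_betw_apply)
  ultimately have "isomorphism U \<kappa> W \<kappa>'' (g \<circ> f)"
    unfolding isomorphism_def partial_morphism_def by (simp add: bij_betw_def)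
  then show ?thesis
    unfolding isomorphic_def by blast
qed

lemma isomorphic_subset:
  assumes "isomorphic V \<kappa> W \<kappa>'" "A \<subseteq> W"
  obtains B where "B \<subseteq> V" "isomorphic B \<kappa> A \<kappa>'"
proof -
  obtain f where f: "bij_betw f V W" "\<forall>a\<in>V. \<forall>b\<in>V. \<kappa> a b = \<kappa>' (f a) (f b)"
    using assms by (auto simp: isomorphic_def isomorphism_def partial_morphism_def)
  let ?B = "{x\<in>V. f x \<in> A}"
  have "bij_betw f ?B A"
    using f(1) assms(2) by (auto simp: bij_betw_def inj_on_def)
  then have "isomorphism ?B \<kappa> A \<kappa>' f"
    using f(2) by (simp add: isomorphism_def partial_morphism_def bij_betw_def)
  then have "isomorphic ?B \<kappa> A \<kappa>'"
    unfolding isomorphic_def by blast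
  with that[of ?B] show ?thesis by simp
qed

lemma isomorphic_finite_iff: "isomorphic V \<kappa> W \<kappa>' \<Longrightarrow> finite V \<longleftrightarrow> finite W"
  by (auto simp: isomorphic_def isomorphism_def dest: bij_betw_finite)

lemma isomorphic_empty_iff: "isomorphic V \<kappa> W \<kappa>' \<Longrightarrow> V = {} \<longleftrightarrow> W = {}"
  by (auto simp: isomorphic_def isomorphism_def bij_betw_def)

lemma proper_finitary_structure_skeleton:
  assumes "dgec V \<kappa>"
  shows "proper_finitary_structure (skeleton V \<kappa>)"
proof -
  have sub: "(A, \<kappa>') \<in> skeleton V \<kappa>"
    if W: "(W, \<kappa>') \<in> skeleton V \<kappa>" and A: "A \<subseteq> W" "A \<noteq> {}" for W \<kappa>' A
  proof -
    obtain B where B: "B \<subseteq> V" "finite B" "isomorphic B \<kappa> W \<kappa>'" and "dgec W \<kappa>'"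
      using W by (auto simp: skeleton_def)
    obtain C where C: "C \<subseteq> B" "isomorphic C \<kappa> A \<kappa>'"
      using isomorphic_subset[OF B(3) A(1)] .
    have "C \<noteq> {}" "finite C" "C \<subseteq> V"
      using isomorphic_empty_iff[OF C(2)] A(2) B C(1) by (auto intro: finite_subset)
    moreover have "dgec A \<kappa>'"
      using \<open>dgec W \<kappa>'\<close> A(1) unfolding dgec_def by blast
    ultimately show ?thesis
      using C(2) by (auto simp: skeleton_def)
  qed
  have fin: "finite W \<and> W \<noteq> {}" if W: "(W, \<kappa>') \<in> skeleton V \<kappa>" for W \<kappa>'
    proof -
    obtain A where A: "finite A" "A \<noteq> {}" "isomorphic A \<kappa> W \<kappa>'"
      using W by (auto simp: skeleton_def)
    show ?thesis
      using A(1,2) isomorphic_finite_iff[OF A(3)] isomorphic_empty_iff[OF A(3)] by simp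
  qed
  have iso: "(W, \<kappa>'') \<in> skeleton V \<kappa>"
    if U: "(U, \<kappa>') \<in> skeleton V \<kappa>" and W: "dgec W \<kappa>''" "isomorphic U \<kappa>' W \<kappa>''" for U W \<kappa>' \<kappa>''
    proof -
    obtain A where A: "A \<subseteq> V" "finite A" "A \<noteq> {}" "isomorphic A \<kappa> U \<kappa>'"
      using U by (auto simp: skeleton_def)
    show ?thesis
      using A(1-3) isomorphic_trans[OF A(4) W(2)] W(1) by (auto simp: skeleton_def)
  qed
  have dg: "dgec W \<kappa>'" if "(W, \<kappa>') \<in> skeleton V \<kappa>" for W \<kappa>'
    using that by (simp add: skeleton_def)
  have "finitary_structure (skeleton V \<kappa>)"
    unfolding finitary_structure_def
  proof (intro conjI)
    show "\<forall>(W, \<kappa>')\<in>skeleton V \<kappa>. dgec W \<kappa>' \<and> finite W \<and> W \<noteq> {}"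
      using fin dg by auto
    show "\<forall>(W, \<kappa>')\<in>skeleton V \<kappa>. \<forall>A. A \<subseteq> W \<and> A \<noteq> {} \<longrightarrow> (A, \<kappa>') \<in> skeleton V \<kappa>"
      using sub by auto
    show "\<forall>(U, \<kappa>')\<in>skeleton V \<kappa>. \<forall>W \<kappa>''. dgec W \<kappa>'' \<and> isomorphic U \<kappa>' W \<kappa>'' \<longrightarrow>
        (W, \<kappa>'') \<in> skeleton V \<kappa>"
      using iso by auto
  qed
  moreover have "\<exists>p. \<forall>(W, \<kappa>')\<in>skeleton V \<kappa>. \<forall>z\<in>W. \<kappa>' z z = p"
  proof (cases "V = {}")
    case True
    then show ?thesis by (auto simp: skeleton_def)
  next
    case False
    then obtain v where v: "v \<in> V" by blast
    have "\<kappa>' z z = \<kappa> v v" if W: "(W, \<kappa>') \<in> skeleton V \<kappa>" and z: "z \<in> W" for W \<kappa>' z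
    proof -
      obtain A f where "A \<subseteq> V" "bij_betw f A W" "\<forall>a\<in>A. \<forall>b\<in>A. \<kappa> a b = \<kappa>' (f a) (f b)"
        using W by (auto simp: skeleton_def isomorphic_def isomorphism_def partial_morphism_def)
      moreover from this z obtain a where "a \<in> A" "z = f a"
        by (metis bij_betw_imp_surj_on imageE)
      ultimately show ?thesis
        using assms v unfolding dgec_def by (metis subsetD)
    qed
    then show ?thesis by blast
  qed
  ultimately show ?thesis
    by (simp add: proper_finitary_structure_def)
qed

end

theory Submission
  imports "HOL-Library.Ramsey" Defs
begin

text \<open>
  Both parts rest on one notion: a sequence \<open>x\<^sub>0, x\<^sub>1, \<dots>\<close> of distinct vertices such that every forward
  edge has color \<open>c\<close> and every backward edge has color \<open>d\<close>. For \<open>c = d\<close> it enumerates a monochromatic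
  set, for \<open>c \<noteq> d\<close> a \<open>(c, d)\<close>-ordered one, so (MBP) and (OBP) together say that the finite sequences
  of this kind have bounded length for each pair of colors. A dGEC that is finitely represented in
  such a class therefore contains no infinite sequence of this kind.

  An absolutely homogeneous dGEC contains none either. Given one, let \<open>S\<close> be the set of all
  vertices that precede every \<open>x\<^sub>i\<close> in the sense of the two colors. The identity on \<open>S\<close> and the shift
  \<open>x\<^sub>i \<mapsto> x\<^sub>i\<^sub>+\<^sub>1\<close> form a partial morphism, so they extend to an automorphism \<open>g\<close>. The vertex \<open>g\<^sup>-\<^sup>1 x\<^sub>0\<close>
  precedes every \<open>x\<^sub>i\<close>, because \<open>x\<^sub>0\<close> precedes every \<open>x\<^sub>i\<^sub>+\<^sub>1\<close>; so it lies in \<open>S\<close> and is fixed by \<open>g\<close>.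
  Hence \<open>x\<^sub>0 \<in> S\<close>, which is absurd (\<open>ab_ho_no_infinite_cd_sequence\<close>). Arbitrarily long finite
  sequences would give an infinite one, since homogeneity allows a sequence of length \<open>n\<close> to be
  continued as soon as some sequence of length \<open>n + 1\<close> exists; this proves (MBP) and (OBP) for
  skeletons.

  It remains to bound the size of a dGEC without infinite sequences of this kind. If the palette is
  finite, Ramsey's theorem shows that the dGEC is finite. In general the ramification argument of
  Erdos and Rado applies. Well-order \<open>V\<close> and color a pair \<open>w < u\<close> by both its colors. To each \<open>v\<close>
  belongs the path of those \<open>u < v\<close> that no earlier member of the path distinguishes from \<open>v\<close>. The
  members \<open>w\<close> of the path for which \<open>(w, v)\<close> has a given color form a homogeneous set, hence a finite
  one; so \<open>w\<close> can be named by this color together with a natural number, its rank among the members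
  with that color. The order in which the names occur along the path determines \<open>v\<close>
  (\<open>inj_on_trace\<close>), and this embeds \<open>V\<close> into the power set of a set whose size is that of the palette
  or \<open>\<aleph>\<^sub>0\<close>, whichever is larger.
\<close>

section \<open>Sequences whose forward and backward edges have constant colors\<close>

text \<open>The index set \<open>I\<close> is \<open>{..<n}\<close> for a sequence of length \<open>n\<close> and \<open>UNIV\<close> for an infinite one.\<close>

definition cd_sequence ::
  "'c \<Rightarrow> 'c \<Rightarrow> 'v set \<Rightarrow> ('v \<Rightarrow> 'v \<Rightarrow> 'c) \<Rightarrow> nat set \<Rightarrow> (nat \<Rightarrow> 'v) \<Rightarrow> bool" where
  "cd_sequence c d V \<kappa> I x \<longleftrightarrow> inj_on x I \<and> x ` I \<subseteq> V \<and>
     (\<forall>i\<in>I. \<forall>j\<in>I. i < j \<longrightarrow> \<kappa> (x i) (x j) = c \<and> \<kappa> (x j) (x i) = d)"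

lemma dgec_eq_iff: "dgec V \<kappa> \<Longrightarrow> x \<in> V \<Longrightarrow> y \<in> V \<Longrightarrow> z \<in> V \<Longrightarrow> \<kappa> x y = \<kappa> z z \<longleftrightarrow> x = y"
  unfolding dgec_def by blast

lemma paletteI: "x \<in> V \<Longrightarrow> y \<in> V \<Longrightarrow> x \<noteq> y \<Longrightarrow> \<kappa> x y \<in> palette V \<kappa>"
  unfolding palette_def by blast

lemma cd_sequence_subset: "cd_sequence c d V \<kappa> I x \<Longrightarrow> J \<subseteq> I \<Longrightarrow> cd_sequence c d V \<kappa> J x"
  unfolding cd_sequence_def by (auto intro: inj_on_subset)

lemma cd_sequence_cong:
  assumes "cd_sequence c d V \<kappa> I x" "\<And>i. i \<in> I \<Longrightarrow> x i = y i"
  shows "cd_sequence c d V \<kappa> I y"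
  using assms(1) inj_on_cong[of I x y] image_cong[of I I x y] assms(2)
  unfolding cd_sequence_def by simp

lemma cd_sequence_image:
  assumes "cd_sequence c d V \<kappa> I x" "V \<subseteq> A" "inj_on f A" "partial_morphism V' \<kappa> W \<kappa>' A f"
  shows "cd_sequence c d W \<kappa>' I (f \<circ> x)"
proof -
  have "inj_on (f \<circ> x) I"
    using assms(1-3) unfolding cd_sequence_def by (meson comp_inj_on inj_on_subset order_trans)
  moreover have "(f \<circ> x) ` I \<subseteq> W"
    using assms unfolding cd_sequence_def partial_morphism_def by fastforce
  moreover have "x i \<in> A" if "i \<in> I" for i
    using assms(1,2) that unfolding cd_sequence_def by blast
  ultimately show ?thesis
    using assms(1,4) unfolding cd_sequence_def partial_morphism_def by simp
qed

lemma isomorphic_sym: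
  assumes "isomorphic V \<kappa> W \<kappa>'"
  shows "isomorphic W \<kappa>' V \<kappa>"
proof -
  obtain f where f: "bij_betw f V W" "\<forall>a\<in>V. \<forall>b\<in>V. \<kappa> a b = \<kappa>' (f a) (f b)"
    using assms by (auto simp: isomorphic_def isomorphism_def partial_morphism_def)
  let ?g = "inv_into V f"
  have g: "bij_betw ?g W V"
    using f(1) by (rule bij_betw_inv_into)
  have "\<kappa>' a b = \<kappa> (?g a) (?g b)" if "a \<in> W" "b \<in> W" for a b
    using that f bij_betw_apply[OF g] by (simp add: bij_betw_inv_into_right)
  then have "isomorphism W \<kappa>' V \<kappa> ?g"
    using g by (simp add: isomorphism_def partial_morphism_def bij_betw_imp_surj_on)
  then show ?thesis
    unfolding isomorphic_def by blast
qed

lemma isomorphic_cd_sequence: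
  assumes "isomorphic V \<kappa> W \<kappa>'" "cd_sequence c d V \<kappa> I x"
  obtains y where "cd_sequence c d W \<kappa>' I y" "y ` I = W \<longleftrightarrow> x ` I = V"
proof -
  obtain f where f: "partial_morphism V \<kappa> W \<kappa>' V f" "bij_betw f V W"
    using assms by (auto simp: isomorphic_def isomorphism_def)
  have "cd_sequence c d W \<kappa>' I (f \<circ> x)"
    using cd_sequence_image[OF assms(2) order_refl _ f(1)] f(2) by (simp add: bij_betw_def)
  moreover have "x ` I \<subseteq> V"
    using assms(2) by (simp add: cd_sequence_def)
  then have "(f \<circ> x) ` I = W \<longleftrightarrow> x ` I = V"
    using f(2) inj_on_image_eq_iff[of f V "x ` I" V] by (simp add: image_image bij_betw_def)
  ultimately show ?thesis
    by (rule that)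
qed

lemma cd_sequence_card:
  assumes "cd_sequence c d V \<kappa> {..<n} x" "x ` {..<n} = V"
  shows "card V = n"
  using assms card_image[of x "{..<n}"] by (simp add: cd_sequence_def)

lemma cd_sequence_monochromatic:
  assumes "cd_sequence c c V \<kappa> I x" "x ` I = V"
  shows "monochromatic c V \<kappa>"
proof -
  have "\<kappa> (x i) (x j) = c" if "i \<in> I" "j \<in> I" "x i \<noteq> x j" for i j
    using assms(1) that unfolding cd_sequence_def by (metis nat_neq_iff)
  then show ?thesis
    unfolding monochromatic_def assms(2)[symmetric] by blast
qed

lemma monochromatic_cd_sequence:
  assumes "monochromatic c V \<kappa>" "finite V"
  obtains x where "cd_sequence c c V \<kappa> {..<card V} x"
proof -
  obtain x where x: "bij_betw x {..<card V} V"
    using ex_bij_betw_nat_finite[OF assms(2)] by (auto simp: lessThan_atLeast0)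
  have "\<kappa> (x i) (x j) = c" if "i < card V" "j < card V" "i \<noteq> j" for i j
  proof -
    have "x i \<in> V" "x j \<in> V" "x i \<noteq> x j"
      using that x unfolding bij_betw_def by (auto dest: inj_onD)
    then show ?thesis
      using assms(1) by (simp add: monochromatic_def)
  qed
  then have "cd_sequence c c V \<kappa> {..<card V} x"
    using x by (simp add: cd_sequence_def bij_betw_def)
  then show ?thesis
    by (rule that)
qed

lemma cd_sequence_cd_ordered:
  assumes x: "cd_sequence c d V \<kappa> I x" "x ` I = V" and "c \<noteq> d"
  shows "cd_ordered c d V \<kappa>"
proof -
  let ?r = "{(x i, x j) | i j. i \<in> I \<and> j \<in> I \<and> i \<le> j}"
  have inj: "inj_on x I"
    using x by (simp add: cd_sequence_def)
  have mem: "(x i, x j) \<in> ?r \<longleftrightarrow> i \<le> j" if "i \<in> I" "j \<in> I" for i j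
    using that inj by (auto dest: inj_onD)
  have "refl_on V ?r" "?r \<subseteq> V \<times> V"
    using x(2) by (auto simp: refl_on_def)
  moreover have "trans ?r"
  proof (rule transI)
    fix a b e
    assume "(a, b) \<in> ?r" "(b, e) \<in> ?r"
    then obtain i j k l where "a = x i" "b = x j" "i \<le> j" "b = x k" "e = x l" "k \<le> l"
      and "i \<in> I" "j \<in> I" "k \<in> I" "l \<in> I"
      by blast
    moreover from this have "j = k"
      using inj by (auto dest: inj_onD)
    ultimately show "(a, e) \<in> ?r"
      using mem by auto
  qed
  moreover have "antisym ?r"
  proof (rule antisymI)
    fix a b
    assume ab: "(a, b) \<in> ?r" "(b, a) \<in> ?r"
    then obtain i j where "a = x i" "b = x j" "i \<in> I" "j \<in> I"
      by blast
    then show "a = b"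
      using ab mem[of i j] mem[of j i] by (metis le_antisym)
  qed
  moreover have "total_on V ?r"
    unfolding total_on_def
  proof (intro ballI impI)
    fix a b
    assume "a \<in> V" "b \<in> V"
    then obtain i j where ij: "a = x i" "b = x j" "i \<in> I" "j \<in> I"
      using x(2) by blast
    show "(a, b) \<in> ?r \<or> (b, a) \<in> ?r"
      unfolding ij(1,2) mem[OF ij(3,4)] mem[OF ij(4,3)] by (rule linear)
  qed
  ultimately have "linear_order_on V ?r"
    by (simp add: order_on_defs)
  moreover have "((u, v) \<in> ?r \<longleftrightarrow> \<kappa> u v = c) \<and> (\<kappa> u v = c \<longleftrightarrow> \<kappa> v u = d)"
    if uv: "u \<in> V" "v \<in> V" "u \<noteq> v" for u v
  proof -
    obtain i j where ij: "u = x i" "v = x j" "i \<in> I" "j \<in> I"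
      using uv(1,2) x(2) by blast
    have col: "\<kappa> (x k) (x l) = c" "\<kappa> (x l) (x k) = d" if "k \<in> I" "l \<in> I" "k < l" for k l
      using x(1) that by (auto simp: cd_sequence_def)
    from uv(3) ij consider "i < j" | "j < i"
      by (metis nat_neq_iff)
    then show ?thesis
    proof cases
      case 1
      then show ?thesis
        using col[OF ij(3,4)] mem[OF ij(3,4)] ij(1,2) by simp
    next
      case 2
      then show ?thesis
        using col[OF ij(4,3)] mem[OF ij(3,4)] ij(1,2) \<open>c \<noteq> d\<close> by simp
    qed
  qed
  ultimately show ?thesis
    unfolding cd_ordered_def by blast
qed

lemma finite_linear_order_enumeration:
  assumes "linear_order_on W r" "finite W"
  obtains x where "bij_betw x {..<card W} W" "\<And>i j. i < j \<Longrightarrow> j < card W \<Longrightarrow> (x i, x j) \<in> r"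
proof -
  define pos where "pos u = card {w \<in> W. (w, u) \<in> r \<and> w \<noteq> u}" for u
  have r: "trans r" "antisym r" "total_on W r" "refl_on W r"
    using assms(1) by (auto simp: order_on_defs)
  have mono: "pos u < pos v" if "u \<in> W" "v \<in> W" "(u, v) \<in> r" "u \<noteq> v" for u v
    unfolding pos_def
  proof (rule psubset_card_mono)
    show "finite {w \<in> W. (w, v) \<in> r \<and> w \<noteq> v}"
      using assms(2) by simp
    have "{w \<in> W. (w, u) \<in> r \<and> w \<noteq> u} \<subseteq> {w \<in> W. (w, v) \<in> r \<and> w \<noteq> v}"
      using that r(1,2) by (auto dest: transD antisymD)
    then show "{w \<in> W. (w, u) \<in> r \<and> w \<noteq> u} \<subset> {w \<in> W. (w, v) \<in> r \<and> w \<noteq> v}"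
      using that by blast
  qed
  have inj: "inj_on pos W"
    using mono r(3) unfolding inj_on_def total_on_def by (metis nat_neq_iff)
  have "pos u < card W" if "u \<in> W" for u
    unfolding pos_def using assms(2) that by (intro psubset_card_mono) auto
  then have "pos ` W = {..<card W}"
    using inj assms(2) by (intro card_subset_eq) (auto simp: card_image)
  then have bij: "bij_betw pos W {..<card W}"
    using inj by (simp add: bij_betw_def)
  let ?x = "inv_into W pos"
  have x: "bij_betw ?x {..<card W} W"
    using bij by (rule bij_betw_inv_into)
  moreover have "(?x i, ?x j) \<in> r" if ij: "i < j" "j < card W" for i j
  proof -
    have "pos (?x i) = i" "pos (?x j) = j" "?x i \<in> W" "?x j \<in> W"
      using bij x ij by (auto simp: bij_betw_inv_into_right bij_betw_apply)
    then show ?thesis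
      using mono[of "?x j" "?x i"] r(3) ij(1) unfolding total_on_def by fastforce
  qed
  ultimately show ?thesis
    by (rule that)
qed

lemma cd_ordered_cd_sequence:
  assumes "cd_ordered c d V \<kappa>" "finite V"
  obtains x where "cd_sequence c d V \<kappa> {..<card V} x"
proof -
  obtain r where r: "linear_order_on V r"
    and col: "\<And>u v. u \<in> V \<Longrightarrow> v \<in> V \<Longrightarrow> u \<noteq> v \<Longrightarrow>
      ((u, v) \<in> r \<longleftrightarrow> \<kappa> u v = c) \<and> (\<kappa> u v = c \<longleftrightarrow> \<kappa> v u = d)"
    using assms(1) unfolding cd_ordered_def by blast
  obtain x where x: "bij_betw x {..<card V} V" "\<And>i j. i < j \<Longrightarrow> j < card V \<Longrightarrow> (x i, x j) \<in> r"
    using finite_linear_order_enumeration[OF r assms(2)] by blast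
  have "\<kappa> (x i) (x j) = c \<and> \<kappa> (x j) (x i) = d" if "i < j" "j < card V" for i j
  proof -
    have "x i \<in> V" "x j \<in> V" "x i \<noteq> x j"
      using that x(1) unfolding bij_betw_def by (auto dest: inj_onD)
    then show ?thesis
      using col x(2)[OF that] by blast
  qed
  then have "cd_sequence c d V \<kappa> {..<card V} x"
    using x(1) by (simp add: cd_sequence_def bij_betw_def)
  then show ?thesis
    by (rule that)
qed

section \<open>Absolutely homogeneous dGECs\<close>

lemma ab_ho_extend:
  assumes "ab_ho V \<kappa>" "A \<subseteq> V" "f ` A \<subseteq> V" "\<And>a b. a \<in> A \<Longrightarrow> b \<in> A \<Longrightarrow> \<kappa> a b = \<kappa> (f a) (f b)"
  shows "\<exists>g. bij_betw g V V \<and> (\<forall>a\<in>V. \<forall>b\<in>V. \<kappa> (g a) (g b) = \<kappa> a b) \<and> (\<forall>a\<in>A. g a = f a)"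
proof -
  have "partial_morphism V \<kappa> V \<kappa> A f"
    using assms(2-4) by (simp add: partial_morphism_def)
  then obtain g where "automorphism V \<kappa> g" "\<forall>a\<in>A. g a = f a"
    using assms(1) unfolding ab_ho_def by blast
  then show ?thesis
    unfolding automorphism_def isomorphism_def partial_morphism_def by metis
qed

lemma ab_ho_no_infinite_cd_sequence:
  assumes ho: "ab_ho V \<kappa>"
  shows "\<not> cd_sequence c d V \<kappa> UNIV x"
proof
  assume x: "cd_sequence c d V \<kappa> UNIV x"
  then have inj: "inj x" and xV: "x i \<in> V" for i
    by (auto simp: cd_sequence_def)
  have col: "\<kappa> (x i) (x j) = c" "\<kappa> (x j) (x i) = d" if "i < j" for i j
    using x that by (auto simp: cd_sequence_def)
  have V: "dgec V \<kappa>"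
    using ho by (simp add: ab_ho_def)
  define S where "S = {v \<in> V. \<forall>i. \<kappa> v (x i) = c \<and> \<kappa> (x i) v = d}"
  have notS: "x i \<notin> S" for i
  proof
    assume "x i \<in> S"
    then have "\<kappa> (x i) (x i) = c"
      unfolding S_def by blast
    then show False
      using col(1)[of i "Suc i"] dgec_eq_iff[OF V xV xV xV, of i "Suc i" i] inj
      by (simp add: inj_eq)
  qed
  define f where "f v = (if v \<in> S then v else x (Suc (inv x v)))" for v
  have fx: "f (x i) = x (Suc i)" for i
    using notS inj by (simp add: f_def)
  have shift: "\<kappa> (x i) (x j) = \<kappa> (x (Suc i)) (x (Suc j))" for i j
    using col[of i j] col[of j i] col[of "Suc i" "Suc j"] col[of "Suc j" "Suc i"]
      dgec_eq_iff[OF V xV xV xV, of i i "Suc i"]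
    by (cases i j rule: linorder_cases) auto
  have fS: "f v = v" if "v \<in> S" for v
    using that by (simp add: f_def)
  have S: "S \<subseteq> V" "\<And>v i. v \<in> S \<Longrightarrow> \<kappa> v (x i) = c \<and> \<kappa> (x i) v = d"
    unfolding S_def by blast+
  have morph: "\<kappa> a b = \<kappa> (f a) (f b)" if "a \<in> S \<union> range x" "b \<in> S \<union> range x" for a b
    using that
  proof (elim UnE rangeE)
    show "\<kappa> a b = \<kappa> (f a) (f b)" if "a = x i" "b = x j" for i j
      unfolding that fx by (rule shift)
  qed (simp_all add: fS fx S(2))
  have dom: "S \<union> range x \<subseteq> V" "f ` (S \<union> range x) \<subseteq> V"
    using fx fS xV S(1) by auto
  obtain g where g: "bij_betw g V V" "\<And>a b. a \<in> V \<Longrightarrow> b \<in> V \<Longrightarrow> \<kappa> (g a) (g b) = \<kappa> a b"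
    "\<And>a. a \<in> S \<union> range x \<Longrightarrow> g a = f a"
    using ab_ho_extend[OF ho dom morph] by blast
  obtain m where m: "m \<in> V" "g m = x 0"
    using g(1) xV[of 0] unfolding bij_betw_def by (metis imageE)
  have "\<kappa> m (x i) = c \<and> \<kappa> (x i) m = d" for i
    using g(2)[OF m(1) xV[of i]] g(2)[OF xV[of i] m(1)] m(2) g(3)[of "x i"] fx[of i]
      col[of 0 "Suc i"] by simp
  then have "m \<in> S"
    using m(1) by (simp add: S_def)
  then have "g m = m"
    using g(3) by (simp add: f_def)
  then show False
    using \<open>m \<in> S\<close> m(2) notS[of 0] by metis
qed

text \<open>All sequences of a given length are conjugate under automorphisms, so the existence of a
  single longer one already makes each of them extendable.\<close>

lemma ab_ho_cd_sequence_extend: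
  assumes ho: "ab_ho V \<kappa>"
    and x: "cd_sequence c d V \<kappa> {..<n} x" and y: "cd_sequence c d V \<kappa> {..<Suc n} y"
  obtains v where "cd_sequence c d V \<kappa> {..<Suc n} (x(n := v))"
proof -
  have V: "dgec V \<kappa>"
    using ho by (simp add: ab_ho_def)
  have injy: "inj_on y {..<n}" and yV: "\<And>i. i < n \<Longrightarrow> y i \<in> V" and xV: "\<And>i. i < n \<Longrightarrow> x i \<in> V"
    using x y by (auto simp: cd_sequence_def inj_on_def)
  define f where "f = x \<circ> inv_into {..<n} y"
  have fy: "f (y i) = x i" if "i < n" for i
    using that injy by (simp add: f_def)
  have colx: "\<kappa> (x i) (x j) = c" "\<kappa> (x j) (x i) = d"
    and coly: "\<kappa> (y i) (y j) = c" "\<kappa> (y j) (y i) = d" if "i < j" "j < n" for i j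
    using x y that by (auto simp: cd_sequence_def)
  have xy: "\<kappa> (y i) (y j) = \<kappa> (x i) (x j)" if "i < n" "j < n" for i j
    using that colx[of i j] coly[of i j] colx[of j i] coly[of j i] dgec_eq_iff[OF V yV yV xV, of i i i]
    by (cases i j rule: linorder_cases) simp_all
  have morph: "\<kappa> a b = \<kappa> (f a) (f b)" if "a \<in> y ` {..<n}" "b \<in> y ` {..<n}" for a b
  proof -
    obtain i j where "a = y i" "i < n" "b = y j" "j < n"
      using \<open>a \<in> y ` {..<n}\<close> \<open>b \<in> y ` {..<n}\<close> by auto
    then show ?thesis
      using fy xy by simp
  qed
  have dom: "y ` {..<n} \<subseteq> V" "f ` y ` {..<n} \<subseteq> V"
    using xV yV fy by auto
  obtain g where g: "bij_betw g V V" "\<And>a b. a \<in> V \<Longrightarrow> b \<in> V \<Longrightarrow> \<kappa> (g a) (g b) = \<kappa> a b"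
    "\<And>a. a \<in> y ` {..<n} \<Longrightarrow> g a = f a"
    using ab_ho_extend[OF ho dom morph] by blast
  have "partial_morphism V \<kappa> V \<kappa> V g" "inj_on g V"
    using g(1,2) by (auto simp: partial_morphism_def bij_betw_def)
  then have "cd_sequence c d V \<kappa> {..<Suc n} (g \<circ> y)"
    using cd_sequence_image[OF y] by blast
  moreover have "(g \<circ> y) i = (x(n := g (y n))) i" if "i \<in> {..<Suc n}" for i
    using that g(3) fy by (auto simp: less_Suc_eq)
  ultimately have "cd_sequence c d V \<kappa> {..<Suc n} (x(n := g (y n)))"
    by (rule cd_sequence_cong)
  then show ?thesis
    by (rule that)
qed

lemma ab_ho_cd_sequence_bounded:
  assumes ho: "ab_ho V \<kappa>"
  shows "\<exists>\<mu>::nat. \<mu> > 0 \<and> (\<forall>n x. cd_sequence c d V \<kappa> {..<n} x \<longrightarrow> n \<le> \<mu>)"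
proof -
  have "\<exists>\<mu>::nat. \<forall>n x. cd_sequence c d V \<kappa> {..<n} x \<longrightarrow> n \<le> \<mu>"
  proof (rule ccontr)
    assume unbounded: "\<not> ?thesis"
    have ex: "\<exists>y. cd_sequence c d V \<kappa> {..<n} y" for n
    proof -
      obtain m y where "cd_sequence c d V \<kappa> {..<m} y" "n < m"
        using unbounded by (metis not_le)
      then show ?thesis
        using cd_sequence_subset[of c d V \<kappa> "{..<m}" y "{..<n}"] by auto
    qed
    have "\<exists>X. \<forall>n. cd_sequence c d V \<kappa> {..<n} (X n) \<and> (\<exists>v. X (Suc n) = (X n)(n := v))"
    proof (rule dependent_nat_choice)
      show "\<exists>y. cd_sequence c d V \<kappa> {..<0} y"
        by (rule ex)
      show "\<exists>y. cd_sequence c d V \<kappa> {..<Suc n} y \<and> (\<exists>v. y = x(n := v))"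
        if "cd_sequence c d V \<kappa> {..<n} x" for x n
        using ab_ho_cd_sequence_extend[OF ho that] ex[of "Suc n"] by metis
    qed
    then obtain X where X: "\<And>n. cd_sequence c d V \<kappa> {..<n} (X n)"
      and step: "\<And>n. \<exists>v. X (Suc n) = (X n)(n := v)"
      by blast
    have stable: "X n i = X (Suc i) i" if "i < n" for i n
      using that
    proof (induction n)
      case (Suc n)
      then show ?case
        using step[of n] by (cases "i = n") auto
    qed simp
    \<comment> \<open>Each pair of indices lies below a bound at which the diagonal sequence agrees with \<open>X\<close>.\<close>
    define x where "x i = X (Suc i) i" for i
    have agree: "x i = X n i" if "i < n" for i n
      using stable[OF that] by (simp add: x_def)
    have "x i \<noteq> x j \<and> x i \<in> V \<and> \<kappa> (x i) (x j) = c \<and> \<kappa> (x j) (x i) = d" if "i < j" for i j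
    proof -
      have "cd_sequence c d V \<kappa> {..<Suc j} x"
        using X[of "Suc j"] by (rule cd_sequence_cong) (simp add: agree)
      then show ?thesis
        using that by (auto simp: cd_sequence_def inj_on_def)
    qed
    then have "cd_sequence c d V \<kappa> UNIV x"
      unfolding cd_sequence_def inj_on_def by (metis UNIV_I image_subsetI lessI nat_neq_iff)
    then show False
      using ab_ho_no_infinite_cd_sequence[OF ho] by blast
  qed
  then obtain \<mu> where "\<forall>n x. cd_sequence c d V \<kappa> {..<n} x \<longrightarrow> n \<le> \<mu>"
    by blast
  then have "Suc \<mu> > 0 \<and> (\<forall>n x. cd_sequence c d V \<kappa> {..<n} x \<longrightarrow> n \<le> Suc \<mu>)"
    using le_SucI by blast
  then show ?thesis
    by (rule exI)
qed

lemma skeleton_cd_sequence: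
  assumes "(W, \<kappa>') \<in> skeleton V \<kappa>" "cd_sequence c d W \<kappa>' I y"
  obtains x where "cd_sequence c d V \<kappa> I x"
proof -
  obtain A where A: "A \<subseteq> V" "isomorphic A \<kappa> W \<kappa>'"
    using assms(1) by (auto simp: skeleton_def)
  obtain x where "cd_sequence c d A \<kappa> I x"
    by (rule isomorphic_cd_sequence[OF isomorphic_sym[OF A(2)] assms(2)])
  then have "cd_sequence c d V \<kappa> I x"
    using A(1) by (auto simp: cd_sequence_def)
  then show ?thesis
    by (rule that)
qed

lemma skeleton_finite:
  assumes "(W, \<kappa>') \<in> skeleton V \<kappa>"
  shows "finite W"
proof -
  obtain A where "finite A" "isomorphic A \<kappa> W \<kappa>'"
    using assms by (auto simp: skeleton_def)
  then show ?thesis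
    using isomorphic_finite_iff by metis
qed

lemma MBP_skeleton:
  assumes "ab_ho V \<kappa>"
  shows "MBP (skeleton V \<kappa>)"
  unfolding MBP_def
proof
  fix c
  obtain \<mu> :: nat where \<mu>: "\<mu> > 0" "\<And>n x. cd_sequence c c V \<kappa> {..<n} x \<Longrightarrow> n \<le> \<mu>"
    using ab_ho_cd_sequence_bounded[OF assms, of c c] by metis
  have "card W \<le> \<mu>" if W: "(W, \<kappa>') \<in> skeleton V \<kappa>" "monochromatic c W \<kappa>'" for W \<kappa>'
  proof -
    obtain y where "cd_sequence c c W \<kappa>' {..<card W} y"
      using monochromatic_cd_sequence[OF W(2) skeleton_finite[OF W(1)]] .
    then obtain x where "cd_sequence c c V \<kappa> {..<card W} x"
      by (rule skeleton_cd_sequence[OF W(1)])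
    then show ?thesis
      by (rule \<mu>(2))
  qed
  then show "\<exists>\<mu>::nat. \<mu> > 0 \<and> (\<forall>(W, \<kappa>')\<in>skeleton V \<kappa>. monochromatic c W \<kappa>' \<longrightarrow> card W \<le> \<mu>)"
    using \<mu>(1) by (intro exI[of _ \<mu>]) auto
qed

lemma OBP_skeleton:
  assumes "ab_ho V \<kappa>"
  shows "OBP (skeleton V \<kappa>)"
  unfolding OBP_def
proof (intro ballI impI)
  fix c d
  obtain \<mu> :: nat where \<mu>: "\<mu> > 0" "\<And>n x. cd_sequence c d V \<kappa> {..<n} x \<Longrightarrow> n \<le> \<mu>"
    using ab_ho_cd_sequence_bounded[OF assms, of c d] by metis
  have "card W \<le> \<mu>" if W: "(W, \<kappa>') \<in> skeleton V \<kappa>" "cd_ordered c d W \<kappa>'" for W \<kappa>'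
  proof -
    obtain y where "cd_sequence c d W \<kappa>' {..<card W} y"
      using cd_ordered_cd_sequence[OF W(2) skeleton_finite[OF W(1)]] .
    then obtain x where "cd_sequence c d V \<kappa> {..<card W} x"
      by (rule skeleton_cd_sequence[OF W(1)])
    then show ?thesis
      by (rule \<mu>(2))
  qed
  then show "\<exists>\<mu>::nat. \<mu> > 0 \<and> (\<forall>(W, \<kappa>')\<in>skeleton V \<kappa>. cd_ordered c d W \<kappa>' \<longrightarrow> card W \<le> \<mu>)"
    using \<mu>(1) by (intro exI[of _ \<mu>]) auto
qed

section \<open>Finite representability in a class with both boundedness properties\<close>

lemma finitely_represented_no_infinite_cd_sequence:
  assumes V: "finitely_represented V \<kappa> F" and F: "MBP F" "OBP F"
  shows "\<not> cd_sequence c d V \<kappa> UNIV x"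
proof
  assume x: "cd_sequence c d V \<kappa> UNIV x"
  \<comment> \<open>The first \<open>n\<close> vertices form a dGEC that belongs to the class.\<close>
  have member: "\<exists>W \<kappa>' y. (W, \<kappa>') \<in> F \<and> cd_sequence c d W \<kappa>' {..<n} y \<and> y ` {..<n} = W"
    if "n > 0" for n
  proof -
    have "x ` {..<n} \<subseteq> V" "finite (x ` {..<n})" "x ` {..<n} \<noteq> {}"
      using x that by (auto simp: cd_sequence_def)
    then obtain W \<kappa>' where W: "(W, \<kappa>') \<in> F" "isomorphic (x ` {..<n}) \<kappa> W \<kappa>'"
      using V unfolding finitely_represented_def belongs_to_def by blast
    have "cd_sequence c d (x ` {..<n}) \<kappa> {..<n} x"
      using x by (auto simp: cd_sequence_def inj_on_def)
    then show ?thesis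
      using isomorphic_cd_sequence[OF W(2)] W(1) by metis
  qed
  obtain W \<kappa>' y where W: "(W, \<kappa>') \<in> F" "cd_sequence c d W \<kappa>' {..<2} y"
    using member[of 2] by auto
  have "y 0 \<in> W" "y 1 \<in> W" "y 0 \<noteq> y 1" "\<kappa>' (y 0) (y 1) = c" "\<kappa>' (y 1) (y 0) = d"
    using W(2) inj_onD[of y "{..<2}" 0 1] by (auto simp: cd_sequence_def)
  then have "c \<in> palette W \<kappa>'" "d \<in> palette W \<kappa>'"
    using paletteI by metis+
  then have cd: "c \<in> class_palette F" "d \<in> class_palette F"
    using W(1) by (auto simp: class_palette_def)
  show False
  proof (cases "c = d")
    case True
    obtain \<mu> :: nat where \<mu>: "\<forall>(W, \<kappa>')\<in>F. monochromatic c W \<kappa>' \<longrightarrow> card W \<le> \<mu>"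
      using F(1) cd(1) unfolding MBP_def by blast
    obtain W \<kappa>' y where "(W, \<kappa>') \<in> F" "cd_sequence c d W \<kappa>' {..<Suc \<mu>} y" "y ` {..<Suc \<mu>} = W"
      using member[of "Suc \<mu>"] by auto
    then show False
      using \<mu> True cd_sequence_monochromatic cd_sequence_card by fastforce
  next
    case False
    obtain \<mu> :: nat where \<mu>: "\<forall>(W, \<kappa>')\<in>F. cd_ordered c d W \<kappa>' \<longrightarrow> card W \<le> \<mu>"
      using F(2) cd False unfolding OBP_def by blast
    obtain W \<kappa>' y where "(W, \<kappa>') \<in> F" "cd_sequence c d W \<kappa>' {..<Suc \<mu>} y" "y ` {..<Suc \<mu>} = W"
      using member[of "Suc \<mu>"] by auto
    then show False
      using \<mu> False cd_sequence_cd_ordered cd_sequence_card by fastforce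
  qed
qed

section \<open>The ramification argument\<close>

locale well_ordered_coloring =
  fixes V :: "'v set" and R :: "'v rel" and \<chi> :: "'v \<Rightarrow> 'v \<Rightarrow> 'k"
  assumes R_field: "R \<subseteq> V \<times> V" and R_trans: "trans R" and R_total: "total_on V R" and R_wf: "wf R"
begin

lemma R_irrefl: "(u, u) \<notin> R"
  using R_wf by simp

text \<open>The set of predecessors of \<open>v\<close> in the Erdos--Rado tree.\<close>

definition path :: "'v \<Rightarrow> 'v set" where
  "path v = {u. wfrec R (\<lambda>g u. (u, v) \<in> R \<and> (\<forall>w. (w, u) \<in> R \<and> g w \<longrightarrow> \<chi> w u = \<chi> w v)) u}"

lemma path_iff: "u \<in> path v \<longleftrightarrow> (u, v) \<in> R \<and> (\<forall>w\<in>path v. (w, u) \<in> R \<longrightarrow> \<chi> w u = \<chi> w v)"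
  unfolding path_def mem_Collect_eq by (subst wfrec[OF R_wf]) (auto simp: cut_apply)

lemma path_subset: "path v \<subseteq> V"
  using path_iff R_field by blast

text \<open>Along the path of \<open>v\<close>, each vertex, and likewise \<open>v\<close> itself, is the first one that is
  indistinguishable from \<open>v\<close> by the vertices of the path below it. So it is determined by those
  vertices and their colors towards \<open>v\<close>.\<close>

lemma path_determines_not_less:
  assumes u: "u \<in> insert v (path v)" and u': "u' \<in> insert v' (path v')"
    and below: "{w \<in> path v. (w, u) \<in> R} = {w \<in> path v'. (w, u') \<in> R}"
    and same: "\<And>w. w \<in> path v \<Longrightarrow> (w, u) \<in> R \<Longrightarrow> \<chi> w v = \<chi> w v'"
  shows "(u', u) \<notin> R"
proof
  assume less: "(u', u) \<in> R"
  have "(u', v) \<in> R"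
    using less u path_iff[of u v] transD[OF R_trans] by blast
  moreover have "\<chi> w u' = \<chi> w v" if w: "w \<in> path v" "(w, u') \<in> R" for w
  proof -
    have wu: "(w, u) \<in> R"
      using w(2) less transD[OF R_trans] by blast
    then have "w \<in> path v'"
      using below w(1) by blast
    then have "\<chi> w u' = \<chi> w v'"
      using u' path_iff[of u' v'] w(2) by blast
    then show ?thesis
      using same[OF w(1) wu] by simp
  qed
  ultimately have "u' \<in> path v"
    using path_iff by blast
  then have "(u', u') \<in> R"
    using below less by blast
  then show False
    using R_irrefl by blast
qed

lemma path_determines:
  assumes "u \<in> insert v (path v)" "u' \<in> insert v' (path v')" "v \<in> V" "v' \<in> V"
    and "{w \<in> path v. (w, u) \<in> R} = {w \<in> path v'. (w, u') \<in> R}"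
    and "\<And>w. w \<in> path v \<Longrightarrow> (w, u) \<in> R \<Longrightarrow> \<chi> w v = \<chi> w v'"
  shows "u = u'"
proof -
  have "(u', u) \<notin> R"
    using assms(1,2,5,6) by (rule path_determines_not_less)
  moreover have "(u, u') \<notin> R"
  proof (rule path_determines_not_less[OF assms(2,1) assms(5)[symmetric]])
    show "\<chi> w v' = \<chi> w v" if "w \<in> path v'" "(w, u') \<in> R" for w
      using that assms(5,6) by (metis (no_types, lifting) mem_Collect_eq)
  qed
  moreover have "u \<in> V" "u' \<in> V"
    using assms(1-4) path_subset by blast+
  ultimately show ?thesis
    using R_total unfolding total_on_def by blast
qed

text \<open>The code names a vertex of the path of \<open>v\<close> without mentioning vertices, and the trace of \<open>v\<close>
  is the order of its path expressed in these names. The order is taken reflexive so that the name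
  of the only vertex of a one-element path is recorded as well.\<close>

definition code :: "'v \<Rightarrow> 'v \<Rightarrow> 'k \<times> nat" where
  "code v u = (\<chi> u v, card {w \<in> path v. (w, u) \<in> R \<and> \<chi> w v = \<chi> u v})"

definition trace :: "'v \<Rightarrow> ('k \<times> nat) rel" where
  "trace v = {(code v w, code v u) | w u. w \<in> path v \<and> u \<in> path v \<and> (w, u) \<in> R\<^sup>=}"

lemma trace_subset:
  assumes "\<And>u v. u \<in> V \<Longrightarrow> v \<in> V \<Longrightarrow> u \<noteq> v \<Longrightarrow> \<chi> u v \<in> X" "v \<in> V"
  shows "trace v \<subseteq> (X \<times> UNIV) \<times> (X \<times> UNIV)"
proof -
  have "\<chi> u v \<in> X" if "u \<in> path v" for u
    using assms that path_iff[of u v] path_subset R_irrefl by blast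
  then show ?thesis
    by (auto simp: trace_def code_def)
qed

context
  assumes homogeneous_finite:
    "\<And>k H. H \<subseteq> V \<Longrightarrow> (\<And>w u. w \<in> H \<Longrightarrow> u \<in> H \<Longrightarrow> (w, u) \<in> R \<Longrightarrow> \<chi> w u = k) \<Longrightarrow> finite H"
begin

text \<open>Among the members of a path, the color of a pair depends only on its smaller element, where it
  agrees with the color towards \<open>v\<close>. So each color class of the path is homogeneous.\<close>

lemma finite_path_color: "finite {u \<in> path v. \<chi> u v = k}"
proof (rule homogeneous_finite[where k = k])
  show "{u \<in> path v. \<chi> u v = k} \<subseteq> V"
    using path_subset by blast
  show "\<chi> w u = k" if "w \<in> {u \<in> path v. \<chi> u v = k}" "u \<in> {u \<in> path v. \<chi> u v = k}" "(w, u) \<in> R" for w u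
    using that path_iff[of u v] by auto
qed

text \<open>The rank within a color class separates its members because the class is finite.\<close>

lemma inj_on_code: "inj_on (code v) (path v)"
proof -
  have less: "code v u \<noteq> code v u'" if u: "u \<in> path v" "u' \<in> path v" "(u, u') \<in> R" for u u'
  proof
    assume eq: "code v u = code v u'"
    let ?D = "\<lambda>u. {w \<in> path v. (w, u) \<in> R \<and> \<chi> w v = \<chi> u v}"
    have col: "\<chi> u v = \<chi> u' v"
      using eq by (simp add: code_def)
    have "finite (?D u')"
      by (rule finite_subset[OF _ finite_path_color[of v "\<chi> u' v"]]) blast
    moreover have "?D u \<subseteq> ?D u'" "u \<in> ?D u'" "u \<notin> ?D u"
      using col u R_irrefl transD[OF R_trans] by auto
    then have "?D u \<subset> ?D u'"
      by blast
    ultimately have "card (?D u) < card (?D u')"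
      by (rule psubset_card_mono)
    then show False
      using eq by (simp add: code_def)
  qed
  show ?thesis
  proof (rule inj_onI, rule ccontr)
    fix u u'
    assume u: "u \<in> path v" "u' \<in> path v" "code v u = code v u'" "u \<noteq> u'"
    then have "(u, u') \<in> R \<or> (u', u) \<in> R"
      using path_subset R_total unfolding total_on_def by blast
    then show False
      using less[of u u'] less[of u' u] u by auto
  qed
qed

lemma trace_iff:
  assumes "w \<in> path v" "u \<in> path v"
  shows "(code v w, code v u) \<in> trace v \<longleftrightarrow> (w, u) \<in> R\<^sup>="
  using assms inj_on_code[of v] unfolding trace_def by (auto dest: inj_onD)

text \<open>By well-founded induction along the path of \<open>v\<close>, the vertex that bears a given name is the
  same in both paths, because the names of the earlier vertices agree.\<close>

lemma trace_eq_path: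
  assumes eq: "trace v = trace v'" and v: "v \<in> V" "v' \<in> V" and "u \<in> path v"
  shows "u \<in> path v' \<and> code v u = code v' u"
  using R_wf \<open>u \<in> path v\<close>
proof (induction u rule: wf_induct_rule)
  case (less u)
  have "(code v u, code v u) \<in> trace v'"
    using less.prems trace_iff[of u v u] eq by simp
  then obtain u' where u': "u' \<in> path v'" "code v u = code v' u'"
    unfolding trace_def by blast
  have above: "w \<in> path v' \<and> (w, u') \<in> R" if w: "w \<in> path v" "(w, u) \<in> R" for w
  proof -
    have IH: "w \<in> path v'" "code v w = code v' w"
      using less.IH[OF w(2,1)] by auto
    have "(code v' w, code v' u') \<in> trace v'"
      using trace_iff[of w v u] w less.prems IH u'(2) eq by simp
    then have "(w, u') \<in> R\<^sup>="
      using trace_iff[OF IH(1) u'(1)] by simp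
    moreover have "w \<noteq> u'"
      using inj_onD[OF inj_on_code, of v w u] IH(2) u'(2) w less.prems R_irrefl by auto
    ultimately show ?thesis
      using IH(1) by blast
  qed
  have below: "w \<in> path v \<and> (w, u) \<in> R" if w: "w \<in> path v'" "(w, u') \<in> R" for w
  proof -
    have "(code v' w, code v u) \<in> trace v"
      using trace_iff[of w v' u'] w u' eq by simp
    then obtain a where a: "a \<in> path v" "code v' w = code v a"
      unfolding trace_def by blast
    have "(a, u) \<in> R\<^sup>="
      using trace_iff[OF a(1) less.prems] \<open>(code v' w, code v u) \<in> trace v\<close> a(2) by simp
    moreover have "a \<noteq> u"
      using inj_onD[OF inj_on_code, of v' w u'] a(2) u' w R_irrefl by auto
    ultimately have au: "(a, u) \<in> R"
      by simp
    have "a \<in> path v'" "code v' a = code v' w"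
      using less.IH[OF au a(1)] a(2) by simp_all
    then have "a = w"
      using inj_onD[OF inj_on_code] w(1) by metis
    then show ?thesis
      using a(1) au by blast
  qed
  have "u = u'"
  proof (rule path_determines[of u v u' v'])
    show "{w \<in> path v. (w, u) \<in> R} = {w \<in> path v'. (w, u') \<in> R}"
      using above below by blast
    show "\<chi> w v = \<chi> w v'" if "w \<in> path v" "(w, u) \<in> R" for w
      using less.IH[OF that(2,1)] by (simp add: code_def)
  qed (use less.prems u' v in auto)
  then show ?case
    using u' by simp
qed

lemma inj_on_trace: "inj_on trace V"
proof (rule inj_onI)
  fix v v'
  assume v: "v \<in> V" "v' \<in> V" and eq: "trace v = trace v'"
  have path: "path v = path v'"
    using trace_eq_path[OF eq v] trace_eq_path[OF eq[symmetric] v(2,1)] by blast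
  show "v = v'"
  proof (rule path_determines[of v v v' v'])
    show "{w \<in> path v. (w, v) \<in> R} = {w \<in> path v'. (w, v') \<in> R}"
      using path path_iff by blast
    show "\<chi> w v = \<chi> w v'" if "w \<in> path v" for w
      using trace_eq_path[OF eq v that] by (simp add: code_def)
  qed (use v in auto)
qed

end

lemma infinite_subset_increasing_sequence:
  assumes "infinite H" "H \<subseteq> V"
  shows "\<exists>x :: nat \<Rightarrow> 'v. range x \<subseteq> H \<and> (\<forall>i j. i < j \<longrightarrow> (x i, x j) \<in> R)"
proof -
  \<comment> \<open>\<open>x n\<close> is the least element of \<open>H\<close> not yet enumerated.\<close>
  let ?P = "\<lambda>x n v. v \<in> H - x ` {..<n} \<and> (\<forall>y\<in>H - x ` {..<n}. y \<noteq> v \<longrightarrow> (v, y) \<in> R)"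
  have "\<exists>x. \<forall>n::nat. ?P x n (x n)"
  proof (rule dependent_wellorder_choice)
    fix x :: "nat \<Rightarrow> 'v" and n
    have "H - x ` {..<n} \<noteq> {}"
      using assms(1) by (metis finite.emptyI finite_Diff2 finite_imageI finite_lessThan)
    then obtain v where v: "v \<in> H - x ` {..<n}" "\<And>y. (y, v) \<in> R \<Longrightarrow> y \<notin> H - x ` {..<n}"
      using wfE_min[OF R_wf] by (metis ex_in_conv)
    have "(v, y) \<in> R" if "y \<in> H - x ` {..<n}" "y \<noteq> v" for y
      using v that assms(2) R_total unfolding total_on_def by blast
    then show "\<exists>v. ?P x n v"
      using v(1) by blast
  next
    fix v and f g :: "nat \<Rightarrow> 'v" and n
    assume "\<And>m. m < n \<Longrightarrow> f m = g m"
    then have "f ` {..<n} = g ` {..<n}"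
      by (intro image_cong) auto
    then show "?P f n v = ?P g n v"
      by simp
  qed
  then obtain x :: "nat \<Rightarrow> 'v" where x: "\<And>n. ?P x n (x n)"
    by blast
  have "(x i, x j) \<in> R" if "i < j" for i j
  proof -
    have "x j \<in> H - x ` {..<i}"
      using x[of j] that by auto
    moreover have "x j \<noteq> x i"
      using x[of j] that by auto
    ultimately show ?thesis
      using x[of i] by auto
  qed
  moreover have "range x \<subseteq> H"
    using x by blast
  ultimately show ?thesis
    by blast
qed

end

section \<open>The size of dGECs without infinite sequences\<close>

lemma card_of_Pow_le:
  assumes "|A| \<le>o |B|"
  shows "|Pow A| \<le>o |Pow B|"
proof -
  obtain f where f: "inj_on f A" "f ` A \<subseteq> B"
    using assms unfolding card_of_ordLeq[symmetric] by blast
  then have "inj_on (image f) (Pow A)" "image f ` Pow A \<subseteq> Pow B"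
    by (auto intro: inj_on_image_Pow)
  then show ?thesis
    unfolding card_of_ordLeq[symmetric] by (intro exI conjI)
qed

text \<open>The space that contains the traces: a name is a pair of colors together with a rank.\<close>

lemma card_of_trace_space:
  assumes "infinite K" "|C| \<le>o |K|"
  shows "|Pow (((C \<times> C) \<times> (UNIV :: nat set)) \<times> ((C \<times> C) \<times> (UNIV :: nat set)))| \<le>o |Pow K|"
proof -
  have nat: "|UNIV :: nat set| \<le>o |K|"
    using assms(1) infinite_iff_card_of_nat by blast
  have CC: "|C \<times> C| \<le>o |K|"
    using assms by (simp add: card_of_Sigma_ordLeq_infinite)
  have CCN: "|(C \<times> C) \<times> (UNIV :: nat set)| \<le>o |K|"
    using CC nat assms(1) by (simp add: card_of_Sigma_ordLeq_infinite)
  have "|((C \<times> C) \<times> (UNIV :: nat set)) \<times> ((C \<times> C) \<times> (UNIV :: nat set))| \<le>o |K|"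
    using CCN assms(1) by (simp add: card_of_Sigma_ordLeq_infinite)
  then show ?thesis
    by (rule card_of_Pow_le)
qed

text \<open>An infinite homogeneous set of the coloring of pairs contains an increasing sequence, which the
  hypothesis excludes. So the color classes of the paths are finite and the traces separate the
  vertices.\<close>

theorem card_of_dgec_le_Pow:
  assumes V: "dgec V \<kappa>" and no_seq: "\<And>c d x. \<not> cd_sequence c d V \<kappa> UNIV x"
    and K: "infinite K" "|palette V \<kappa>| \<le>o |K|"
  shows "|V| \<le>o |Pow K|"
proof -
  obtain r where r: "well_order_on V r"
    using well_order_on by blast
  have "antisym r" "trans r"
    using r by (simp_all add: order_on_defs well_order_on_def)
  then have "trans (r - Id)"
    by (rule trans_diff_Id[rotated])
  then interpret well_ordered_coloring V "r - Id" "\<lambda>u v. (\<kappa> u v, \<kappa> v u)"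
    by unfold_locales (use r in \<open>auto simp: order_on_defs well_order_on_def\<close>)
  let ?X = "palette V \<kappa> \<times> palette V \<kappa>"
  have "finite H"
    if H: "H \<subseteq> V" "\<And>w u. w \<in> H \<Longrightarrow> u \<in> H \<Longrightarrow> (w, u) \<in> r - Id \<Longrightarrow> (\<kappa> w u, \<kappa> u w) = k" for k H
  proof (rule ccontr)
    assume "infinite H"
    then obtain x :: "nat \<Rightarrow> 'a" where x: "range x \<subseteq> H" "\<And>i j. i < j \<Longrightarrow> (x i, x j) \<in> r - Id"
      using infinite_subset_increasing_sequence[OF _ H(1)] by blast
    have "x i \<noteq> x j" if "i < j" for i j
      using x(2)[OF that] by auto
    then have "inj x"
      by (rule linorder_injI)
    moreover have "\<kappa> (x i) (x j) = fst k \<and> \<kappa> (x j) (x i) = snd k" if "i < j" for i j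
      using H(2)[OF _ _ x(2)[OF that]] x(1) by (simp add: prod_eq_iff image_subset_iff)
    ultimately have "cd_sequence (fst k) (snd k) V \<kappa> UNIV x"
      using x(1) H(1) by (simp add: cd_sequence_def)
    then show False
      using no_seq by blast
  qed
  then have "inj_on trace V"
    by (rule inj_on_trace)
  moreover have "trace ` V \<subseteq> Pow ((?X \<times> UNIV) \<times> (?X \<times> UNIV))"
  proof (intro image_subsetI PowI trace_subset)
    show "(\<kappa> u v, \<kappa> v u) \<in> ?X" if "u \<in> V" "v \<in> V" "u \<noteq> v" for u v
      using that by (simp add: paletteI)
  qed
  ultimately have "|V| \<le>o |Pow ((?X \<times> (UNIV :: nat set)) \<times> (?X \<times> (UNIV :: nat set)))|"
    unfolding card_of_ordLeq[symmetric] by (intro exI conjI)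
  then show ?thesis
    using card_of_trace_space[OF K] by (rule ordLeq_transitive)
qed

lemma infinite_finite_palette_cd_sequence:
  assumes "infinite V" "finite (palette V \<kappa>)"
  obtains c d x where "cd_sequence c d V \<kappa> UNIV x"
proof -
  obtain h :: "nat \<Rightarrow> 'a" where h: "inj h" "range h \<subseteq> V"
    using assms(1) infinite_countable_subset by blast
  let ?X = "palette V \<kappa> \<times> palette V \<kappa>"
  obtain e where e: "bij_betw e ?X {0..<card ?X}"
    using ex_bij_betw_finite_nat[of ?X] assms(2) by auto
  define \<chi> where "\<chi> i j = (\<kappa> (h i) (h j), \<kappa> (h j) (h i))" for i j
  have \<chi>: "\<chi> i j \<in> ?X" if "i \<noteq> j" for i j
    using that h by (simp add: \<chi>_def paletteI inj_eq image_subset_iff)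
  define f where "f P = e (\<chi> (Min P) (Max P))" for P
  have f: "f {i, j} = e (\<chi> i j)" if "i < j" for i j
    using that by (simp add: f_def)
  have "f {i, j} < card ?X" if "i \<noteq> j" for i j
    using bij_betw_apply[OF e \<chi>[of "Min {i, j}" "Max {i, j}"]] that unfolding f_def by simp
  then have "\<exists>Y t. Y \<subseteq> UNIV \<and> infinite Y \<and> t < card ?X \<and>
      (\<forall>i\<in>Y. \<forall>j\<in>Y. i \<noteq> j \<longrightarrow> f {i, j} = t)"
    by (intro Ramsey2) simp_all
  then obtain Y t where Y: "infinite Y" "\<And>i j. i \<in> Y \<Longrightarrow> j \<in> Y \<Longrightarrow> i \<noteq> j \<Longrightarrow> f {i, j} = t"
    by metis
  define x where "x = h \<circ> enumerate Y"
  obtain c d where cd: "inv_into ?X e t = (c, d)"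
    by (rule prod.exhaust)
  have "\<kappa> (x i) (x j) = c \<and> \<kappa> (x j) (x i) = d" if "i < j" for i j
  proof -
    have ij: "enumerate Y i < enumerate Y j"
      using enumerate_mono[OF that Y(1)] .
    then have "e (\<chi> (enumerate Y i) (enumerate Y j)) = t"
      using f[OF ij] Y(2)[of "enumerate Y i" "enumerate Y j"] enumerate_in_set[OF Y(1)] by simp
    then have "\<chi> (enumerate Y i) (enumerate Y j) = (c, d)"
      using bij_betw_inv_into_left[OF e \<chi>] ij cd by (metis less_irrefl)
    then show ?thesis
      by (simp add: \<chi>_def x_def)
  qed
  moreover have "inj x" "range x \<subseteq> V"
    using h inj_compose[OF h(1) inj_enumerate[OF Y(1)]] by (auto simp: x_def)
  ultimately have "cd_sequence c d V \<kappa> UNIV x"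
    by (simp add: cd_sequence_def)
  then show ?thesis
    by (rule that)
qed

lemma finite_palette:
  assumes "finite V"
  shows "finite (palette V \<kappa>)"
  by (rule finite_subset[of _ "(\<lambda>(x, y). \<kappa> x y) ` (V \<times> V)"]) (use assms in \<open>auto simp: palette_def\<close>)

theorem theorem7p3:
  shows
    "(\<forall>F :: 'c dgec_class.
        proper_finitary_structure F \<and> MBP F \<and> OBP F \<longrightarrow>
        (\<exists>\<mm> :: ('c + nat) set rel. Card_order \<mm> \<and>
           (\<forall>(V :: 'v set) \<kappa>. dgec V \<kappa> \<and> finitely_represented V \<kappa> F \<longrightarrow> |V| \<le>o \<mm>)))
     \<and>
     (\<forall>(V :: 'v set) (\<kappa> :: 'v \<Rightarrow> 'v \<Rightarrow> 'c). ab_ho V \<kappa> \<longrightarrow>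
        MBP (skeleton V \<kappa>) \<and> OBP (skeleton V \<kappa>) \<and>
        (infinite (palette V \<kappa>) \<longrightarrow> |V| \<le>o ctwo ^c |palette V \<kappa>| ) \<and>
        (finite V \<longleftrightarrow> finite (palette V \<kappa>)))"
proof (intro conjI allI impI)
  fix F :: "'c dgec_class"
  assume F: "proper_finitary_structure F \<and> MBP F \<and> OBP F"
  have "|V| \<le>o |Pow (UNIV :: ('c + nat) set)|"
    if V: "dgec V \<kappa>" "finitely_represented V \<kappa> F" for V :: "'v set" and \<kappa>
  proof (rule card_of_dgec_le_Pow[OF V(1)])
    show "\<not> cd_sequence c d V \<kappa> UNIV x" for c d x
      using finitely_represented_no_infinite_cd_sequence[OF V(2)] F by blast
    show "|palette V \<kappa>| \<le>o |UNIV :: ('c + nat) set|"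
      using card_of_ordLeq[of "palette V \<kappa>" "UNIV :: ('c + nat) set"]
      by (meson inj_on_def Inl_inject subset_UNIV)
  qed simp
  then show "\<exists>\<mm> :: ('c + nat) set rel. Card_order \<mm> \<and>
      (\<forall>(V :: 'v set) \<kappa>. dgec V \<kappa> \<and> finitely_represented V \<kappa> F \<longrightarrow> |V| \<le>o \<mm>)"
    using card_of_Card_order by blast
next
  fix V :: "'v set" and \<kappa> :: "'v \<Rightarrow> 'v \<Rightarrow> 'c"
  assume ho: "ab_ho V \<kappa>"
  show "MBP (skeleton V \<kappa>)"
    using ho by (rule MBP_skeleton)
  show "OBP (skeleton V \<kappa>)"
    using ho by (rule OBP_skeleton)
  have V: "dgec V \<kappa>"
    using ho by (simp add: ab_ho_def)
  show "|V| \<le>o ctwo ^c |palette V \<kappa>|" if inf: "infinite (palette V \<kappa>)"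
  proof -
    have "|V| \<le>o |Pow (palette V \<kappa>)|"
      using V ab_ho_no_infinite_cd_sequence[OF ho] inf card_of_mono1[OF order_refl]
      by (rule card_of_dgec_le_Pow)
    then show ?thesis
      using card_of_Pow_Func unfolding cexp_def ctwo_def Field_card_of by (rule ordLeq_ordIso_trans)
  qed
  show "finite V \<longleftrightarrow> finite (palette V \<kappa>)"
  proof
    show "finite V" if fin: "finite (palette V \<kappa>)"
    proof (rule ccontr)
      assume "infinite V"
      then obtain c d x where "cd_sequence c d V \<kappa> UNIV x"
        by (rule infinite_finite_palette_cd_sequence[OF _ fin])
      then show False
        using ab_ho_no_infinite_cd_sequence[OF ho] by blast
    qed
  qed (rule finite_palette)
qed

end
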